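(* Let $n, N > 0$ be integers with $\frac{N}{n}\ge 2$. Then the frame $\mathrm{STF}(N; \frac{N}{n}, \ldots, \frac{N}{n})$ (with $\frac{N}{n}$ repeated $n$ times) is optimally sparse in $\mathcal{F}(N,\{\frac{N}{n}\}_{i=1}^n)$ with respect to the standard unit vector basis of $\mathbb{R}^n$. That is, this frame is $\bigl(N+2(n-\gcd(N,n))\bigr)$-sparse with respect to the standard unit vector basis.
   Context: A frame for $\mathbb{R}^n$ is a finite sequence $(\varphi_i)_{i=1}^N$ in $\mathbb{R}^n$ that spans $\mathbb{R}^n$; it is unit norm if $\|\varphi_i\|=1$ for all $i$. Its frame operator is $S:\mathbb{R}^n\to\mathbb{R}^n$, $Sx=\sum_{i=1}^N\langle x,\varphi_i\rangle\varphi_i$. Class of frames: for real $\lambda_1,\ldots,\lambda_n\ge 2$ with $\sum_{j=1}^n\lambda_j=N$, $\mathcal{F}(N,\{\lambda_i\}_{i=1}^n)$ denotes the class of all unit norm frames $(\varphi_i)_{i=1}^N$ in $\mathbb{R}^n$ whose frame operator has eigenvalues $\lambda_1,\ldots,\lambda_n$ (counted with multiplicity; the ordering is irrelevant). In particular $\mathcal{F}(N,\{\frac{N}{n}\}_{i=1}^n)$ is the class of unit norm tight frames of $N$ vectors in $\mathbb{R}^n$ (all eigenvalues equal to $N/n$). Sparsity: let $(e_j)_{j=1}^n$ be an orthonormal basis of $\mathbb{R}^n$. A frame $(\varphi_i)_{i=1}^N$ for $\mathbb{R}^n$ is $k$-sparse with respect to $(e_j)_{j=1}^n$ if for each $i\in\{1,\ldots,N\}$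 there exists $J_i\subseteq\{1,\ldots,n\}$ such that $\varphi_i\in\mathrm{span}\{e_j: j\in J_i\}$ and $\sum_{i=1}^N|J_i|=k$. Optimal sparsity: given a class $\mathcal{F}$ of frames for $\mathbb{R}^n$, a frame $(\varphi_i)_{i=1}^N\in\mathcal{F}$ is optimally sparse in $\mathcal{F}$ with respect to $(e_j)_{j=1}^n$ if $(\varphi_i)_{i=1}^N$ is $k_1$-sparse with respect to $(e_j)_{j=1}^n$ and there does not exist a frame $(\psi_i)_{i=1}^N\in\mathcal{F}$ which is $k_2$-sparse with respect to $(e_j)_{j=1}^n$ with $k_2<k_1$. Spectral Tetris for Frames (STF): let $(e_j)_{j=1}^n$ be the standard unit vector basis of $\mathbb{R}^n$. Given $n$, $N$, and a sequence $\lambda_1,\ldots,\lambda_n\ge2$ with $\sum_j\lambda_j=N$, the output $\mathrm{STF}(N;\lambda_1,\ldots,\lambda_n)=(\varphi_i)_{i=1}^N$ is produced by the following procedure (the $\lambda_j$ are treated as variables that are updated). Set $i:=1$. For $j=1,\ldots,n$ do: repeat the following step until $\lambda_j=0$: - if $\lambda_j<1$, set $\varphi_i:=\sqrt{\lambda_j/2}\,e_j+\sqrt{1-\lambda_j/2}\,e_{j+1}$ and $\varphi_{i+1}:=\sqrt{\lambda_j/2}\,e_j-\sqrt{1-\lambda_j/2}\,e_{j+1}$; then set $i:=i+2$, then $\lambda_{j+1}:=\lambda_{j+1}-(2-\lambda_j)$, then $\lambda_j:=0$; - else set $\varphi_i:=e_j$, $i:=i+1$, $\lambda_j:=\lambda_j-1$.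 *)

theory Defs
  imports Complex_Main "Jordan_Normal_Form.VS_Connect" "Jordan_Normal_Form.Char_Poly"
begin

text \<open>
  Vectors of $R^n$ are the elements of \<open>carrier_vec n\<close>, and a finite sequence of $N$
  vectors is a list of length $N$. All indices start at 0, so the basis $e_1, \ldots, e_n$
  becomes \<open>e 0, \<dots>, e (n - 1)\<close>, and the standard basis is \<open>unit_vec n\<close>. The values
  $\lambda_1, \ldots, \lambda_n$ are written \<open>\<mu> 0, \<dots>, \<mu> (n - 1)\<close>.
\<close>

abbreviation vec_span :: "nat \<Rightarrow> real vec set \<Rightarrow> real vec set" where
  "vec_span n A \<equiv> LinearCombinations.module.span class_ring (module_vec TYPE(real) n) A"

definition is_frame :: "nat \<Rightarrow> real vec list \<Rightarrow> bool" where
  "is_frame n \<phi> \<longleftrightarrow> set \<phi> \<subseteq> carrier_vec n \<and> vec_span n (set \<phi>) = carrier_vec n"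

definition unit_norm :: "real vec list \<Rightarrow> bool" where
  "unit_norm \<phi> \<longleftrightarrow> (\<forall>v \<in> set \<phi>. sqrt (v \<bullet> v) = 1)"

definition frame_operator :: "nat \<Rightarrow> real vec list \<Rightarrow> real vec \<Rightarrow> real vec" where
  "frame_operator n \<phi> x = foldr (+) (map (\<lambda>v. (x \<bullet> v) \<cdot>\<^sub>v v) \<phi>) (0\<^sub>v n)"

text \<open>Matrix with respect to the standard basis: column \<open>l\<close> is the image of \<open>unit_vec n l\<close>.\<close>

definition frame_operator_mat :: "nat \<Rightarrow> real vec list \<Rightarrow> real mat" where
  "frame_operator_mat n \<phi> = mat n n (\<lambda>(k, l). frame_operator n \<phi> (unit_vec n l) $ k)"

text \<open>
  The class $\mathcal{F}(N, \{\lambda_j\})$. Eigenvalues with multiplicity are the roots of the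
  characteristic polynomial, which also makes the order of the \<open>\<mu> j\<close> irrelevant. The notation
  is meant for \<open>\<mu> j \<ge> 2\<close> with \<open>(\<Sum>j<n. \<mu> j) = N\<close>; only the values at \<open>j < n\<close> matter.
\<close>

definition frame_class :: "nat \<Rightarrow> nat \<Rightarrow> (nat \<Rightarrow> real) \<Rightarrow> real vec list set" where
  "frame_class n N \<mu> = {\<phi>. length \<phi> = N \<and> is_frame n \<phi> \<and> unit_norm \<phi> \<and>
     char_poly (frame_operator_mat n \<phi>) = (\<Prod>j<n. [:- \<mu> j, 1:])}"

text \<open>
  Sparsity with respect to an orthonormal basis \<open>e\<close>. The index sets \<open>J i\<close> need not be minimal,
  so a \<open>k\<close>-sparse frame is also \<open>k'\<close>-sparse for larger \<open>k'\<close> up to \<open>n * length \<phi>\<close>.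
\<close>

definition is_sparse :: "nat \<Rightarrow> (nat \<Rightarrow> real vec) \<Rightarrow> nat \<Rightarrow> real vec list \<Rightarrow> bool" where
  "is_sparse n e k \<phi> \<longleftrightarrow> (\<exists>J :: nat \<Rightarrow> nat set.
     (\<forall>i < length \<phi>. J i \<subseteq> {..<n} \<and> \<phi> ! i \<in> vec_span n (e ` J i)) \<and>
     (\<Sum>i < length \<phi>. card (J i)) = k)"

definition optimally_sparse ::
  "nat \<Rightarrow> (nat \<Rightarrow> real vec) \<Rightarrow> real vec list set \<Rightarrow> real vec list \<Rightarrow> bool" where
  "optimally_sparse n e F \<phi> \<longleftrightarrow> \<phi> \<in> F \<and>
     (\<exists>k\<^sub>1. is_sparse n e k\<^sub>1 \<phi> \<and> \<not> (\<exists>\<psi> \<in> F. \<exists>k\<^sub>2 < k\<^sub>1. is_sparse n e k\<^sub>2 \<psi>))"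

text \<open>
  \<open>stf_loop n j \<mu>\<close> is the list of vectors emitted by the Spectral Tetris procedure from the
  moment its outer loop variable is \<open>j\<close> and its variables $\lambda$ have the values \<open>\<mu>\<close>; the
  output index $i$ is the position in the list. For \<open>j = n - 1\<close>, the last pass, the
  two-vector step would refer to the nonexistent \<open>unit_vec n n\<close> (the zero vector in this
  library) and \<open>\<mu> n\<close>; it is not reached when \<open>\<mu> j \<ge> 2\<close> for \<open>j < n\<close> and \<open>(\<Sum>j<n. \<mu> j)\<close> is
  an integer.
\<close>

function stf_loop :: "nat \<Rightarrow> nat \<Rightarrow> (nat \<Rightarrow> real) \<Rightarrow> real vec list" where
  "stf_loop n j \<mu> =
    (if j \<ge> n then []
     else if \<mu> j = 0 then stf_loop n (Suc j) \<mu>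
     else if \<mu> j < 1 then
       [sqrt (\<mu> j / 2) \<cdot>\<^sub>v unit_vec n j + sqrt (1 - \<mu> j / 2) \<cdot>\<^sub>v unit_vec n (Suc j),
        sqrt (\<mu> j / 2) \<cdot>\<^sub>v unit_vec n j - sqrt (1 - \<mu> j / 2) \<cdot>\<^sub>v unit_vec n (Suc j)]
       @ stf_loop n j (\<mu>(Suc j := \<mu> (Suc j) - (2 - \<mu> j), j := 0))
     else unit_vec n j # stf_loop n j (\<mu>(j := \<mu> j - 1)))"
  by pat_completeness auto
termination
  by (relation "measures [\<lambda>(n, j, \<mu>). n - j,
        \<lambda>(n, j, \<mu>). if \<mu> j = 0 then 0 else Suc (nat \<lceil>\<mu> j\<rceil>)]")
    (auto simp: nat_less_eq_zless ceiling_diff_one)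

declare stf_loop.simps [simp del]

text \<open>STF$(N; \lambda_1, \ldots, \lambda_n)$, where $N$ is determined as the sum of the $\lambda_j$.\<close>

definition STF :: "nat \<Rightarrow> (nat \<Rightarrow> real) \<Rightarrow> real vec list" where
  "STF n \<mu> = stf_loop n 0 \<mu>"

end

theory Submission
  imports Defs "Jordan_Normal_Form.Jordan_Normal_Form_Uniqueness"
    "Jordan_Normal_Form.Schur_Decomposition"
begin

text \<open>
  Put the vectors of a unit norm tight frame into the columns of an $n \times N$ matrix. Its rows
  are orthogonal of squared norm $N/n$, so two rows whose supports meet share at least two
  positions. Collect the rows one by one, always preferring a row that meets those already chosen;
  such a row puts at least two nonzero entries into columns that are already occupied. The
  preference fails only if the $m$ chosen rows form a union of blocks, and then the occupied
  columns, being unit vectors, number $m N / n$, so $m$ is a multiple of $n / \gcd(N, n)$. Hence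
  there are at least $N + 2 (n - \gcd(N, n))$ nonzero entries. Spectral Tetris emits a pair of
  2-sparse vectors at row $j$ exactly when the sum of the eigenvalues after $j$ is not an integer,
  which happens $n - \gcd(N, n)$ times, and all other vectors it emits are 1-sparse.
\<close>

section \<open>Multiples of n / gcd(N, n)\<close>

lemma dvd_mult_iff_div_gcd_dvd:
  fixes m n N :: nat
  assumes "n > 0"
  shows "n dvd m * N \<longleftrightarrow> n div gcd N n dvd m"
proof -
  obtain p q where "N = p * gcd N n" "n = q * gcd N n" "coprime p q"
    using gcd_coprime_exists[of N n] assms by auto
  moreover define g where "g = gcd N n"
  ultimately have *: "N = p * g" "n = q * g" "coprime p q" "g > 0"
    using assms by auto
  have "n dvd m * N \<longleftrightarrow> q * g dvd (m * p) * g" using * by (simp add: mult.assoc)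
  also have "\<dots> \<longleftrightarrow> q dvd m * p" using * by simp
  also have "\<dots> \<longleftrightarrow> q dvd m" using * by (simp add: coprime_dvd_mult_left_iff coprime_commute)
  finally show ?thesis using * unfolding g_def[symmetric] by simp
qed

text \<open>Meant for a sum of \<open>m\<close> equal eigenvalues N / n, whose integrality becomes a
  divisibility condition on \<open>m\<close>.\<close>

lemma real_mult_divide_in_Ints_iff:
  fixes m n N :: nat
  assumes "n > 0"
  shows "real m * (real N / real n) \<in> \<int> \<longleftrightarrow> n div gcd N n dvd m"
proof -
  have "real m * (real N / real n) \<in> \<int> \<longleftrightarrow> real (m * N) / real n \<in> \<int>" by simp
  also have "\<dots> \<longleftrightarrow> n dvd m * N"
  proof
    assume "real (m * N) / real n \<in> \<int>"
    then obtain z where "real (m * N) / real n = of_int z" by (elim Ints_cases)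
    then have "of_int (int (m * N)) = (of_int (z * int n) :: real)"
      using assms by (simp add: field_simps)
    then have "int (m * N) = z * int n" by (simp only: of_int_eq_iff)
    then show "n dvd m * N" by (metis dvd_triv_right int_dvd_int_iff)
  next
    assume "n dvd m * N"
    then obtain k where "m * N = n * k" by blast
    then show "real (m * N) / real n \<in> \<int>" using assms by simp
  qed
  finally show ?thesis using dvd_mult_iff_div_gcd_dvd[OF assms] by simp
qed

text \<open>With q = n / g the multiples in question are q * 0, ..., q * (g - 1).\<close>

lemma card_multiples_below:
  fixes n g :: nat
  assumes "g dvd n" "n > 0"
  shows "card {t. t < n \<and> n div g dvd t} = g"
proof -
  obtain q where q: "n = g * q" using assms by blast
  with assms have pos: "g > 0" "q > 0" by auto
  then have "{t. t < n \<and> n div g dvd t} = (*) q ` {..<g}"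
    unfolding q by (auto simp: dvd_def)
  moreover have "inj ((*) q)" using pos by (auto intro: injI)
  ultimately show ?thesis by (simp add: card_image inj_on_subset)
qed

section \<open>Lower bound on the number of nonzero entries\<close>

text \<open>Here \<open>a i j\<close> is coordinate \<open>j\<close> of vector \<open>i\<close>, so
  a row has fixed \<open>j\<close> and \<open>T j\<close> is its support. The greedy choice of rows
  bounds the sum of the support sizes; counting the same entries by vectors gives the sum in the
  conclusion.\<close>

lemma orthogonal_rows_card_support_ge:
  fixes a :: "nat \<Rightarrow> nat \<Rightarrow> real" and n N :: nat
  assumes n: "n > 0"
    and unit: "\<And>i. i < N \<Longrightarrow> (\<Sum>j<n. (a i j)\<^sup>2) = 1"
    and orth: "\<And>j l. j < n \<Longrightarrow> l < n \<Longrightarrow> j \<noteq> l \<Longrightarrow> (\<Sum>i<N. a i j * a i l) = 0"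
    and row: "\<And>j. j < n \<Longrightarrow> (\<Sum>i<N. (a i j)\<^sup>2) = real N / real n"
  shows "N + 2 * (n - gcd N n) \<le> (\<Sum>i<N. card {j. j < n \<and> a i j \<noteq> 0})"
proof -
  define T where "T j = {i. i < N \<and> a i j \<noteq> 0}" for j
  define q where "q = n div gcd N n"
  have fin: "finite (T j)" for j unfolding T_def by simp
  have overlap: "2 \<le> card (T j \<inter> T l)"
    if jl: "j < n" "l < n" "j \<noteq> l" and ne: "T j \<inter> T l \<noteq> {}" for j l
  proof -
    from ne obtain i where i: "i \<in> T j \<inter> T l" by blast
    \<comment> \<open>If \<open>i\<close> were the only common position, the inner product of the
      two rows would be the single nonzero product there.\<close>
    have "\<not> T j \<inter> T l \<subseteq> {i}"
    proof
      assume sub: "T j \<inter> T l \<subseteq> {i}"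
      have "(\<Sum>i'<N. a i' j * a i' l) = (\<Sum>i'<N. if i' = i then a i j * a i l else 0)"
        using sub by (intro sum.cong) (auto simp: T_def)
      also have "\<dots> = a i j * a i l" using i by (simp add: T_def)
      finally show False using orth[OF jl] i by (simp add: T_def)
    qed
    then obtain i' where "i' \<in> T j \<inter> T l" "i' \<noteq> i" by blast
    with i have "{i, i'} \<subseteq> T j \<inter> T l" by blast
    then have "card {i, i'} \<le> card (T j \<inter> T l)" using fin by (intro card_mono) auto
    with \<open>i' \<noteq> i\<close> show ?thesis by simp
  qed
  have closed: "q dvd card R"
    if R: "R \<subseteq> {..<n}" and disj: "\<And>j. j \<in> {..<n} - R \<Longrightarrow> T j \<inter> \<Union> (T ` R) = {}" for R
  proof -
    define U where "U = \<Union> (T ` R)"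
    have U: "U \<subseteq> {..<N}" unfolding U_def T_def by auto
    \<comment> \<open>The squares in the columns \<open>U\<close> are summed in two ways: each
      column contributes 1, and each row of \<open>R\<close> contributes N / n, because rows outside
      \<open>R\<close> vanish on \<open>U\<close> and rows of \<open>R\<close> vanish off
      \<open>U\<close>.\<close>
    have "real (card U) = (\<Sum>i\<in>U. \<Sum>j<n. (a i j)\<^sup>2)"
      using U unit by (simp add: subset_iff)
    also have "\<dots> = (\<Sum>i\<in>U. \<Sum>j\<in>R. (a i j)\<^sup>2)"
      using R disj U by (intro sum.cong refl sum.mono_neutral_right) (auto simp: U_def T_def)
    also have "\<dots> = (\<Sum>j\<in>R. \<Sum>i\<in>U. (a i j)\<^sup>2)" by (rule sum.swap)
    also have "\<dots> = (\<Sum>j\<in>R. \<Sum>i<N. (a i j)\<^sup>2)"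
      using U by (intro sum.cong refl sum.mono_neutral_left) (auto simp: U_def T_def)
    also have "\<dots> = real (card R) * (real N / real n)"
      using R row by (simp add: subset_iff)
    finally have "real (card U * n) = real (card R * N)" using n by (simp add: field_simps)
    then have "card R * N = card U * n" by linarith
    then have "n dvd card R * N" by simp
    then show ?thesis unfolding q_def using dvd_mult_iff_div_gcd_dvd[OF n] by simp
  qed
  \<comment> \<open>Each new row raises the excess of total support size over occupied columns by at
    least 2, except possibly at stages \<open>t\<close> divisible by \<open>q\<close>. The additive
    form avoids truncated subtraction.\<close>
  have greedy: "\<exists>R \<subseteq> {..<n}. card R = m \<and>
      card (\<Union> (T ` R)) + 2 * m \<le> (\<Sum>j\<in>R. card (T j)) + 2 * card {t. t < m \<and> q dvd t}"
    if "m \<le> n" for m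
    using that
  proof (induction m)
    case 0
    show ?case by (intro exI[of _ "{}"]) simp
  next
    case (Suc m)
    then obtain R where R: "R \<subseteq> {..<n}" "card R = m" and
      le: "card (\<Union> (T ` R)) + 2 * m \<le> (\<Sum>j\<in>R. card (T j)) + 2 * card {t. t < m \<and> q dvd t}"
      by auto
    have finR: "finite R" using R(1) finite_subset by blast
    define U where "U = \<Union> (T ` R)"
    have finU: "finite U" using finR fin unfolding U_def by blast
    have count: "card {t. t < Suc m \<and> q dvd t} = card {t. t < m \<and> q dvd t} + (if q dvd m then 1 else 0)"
    proof -
      have "{t. t < Suc m \<and> q dvd t} = {t. t < m \<and> q dvd t} \<union> (if q dvd m then {m} else {})"
        by (auto simp: less_Suc_eq)
      then show ?thesis by simp
    qed
    \<comment> \<open>If a remaining row meets \<open>U\<close>, the overlap supplies the 2.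
      Otherwise \<open>closed\<close> gives \<open>q dvd m\<close>, the exempt case, where any
      remaining row will do.\<close>
    have "\<exists>j \<in> {..<n} - R. card (U \<union> T j) + 2 \<le> card U + card (T j) + (if q dvd m then 2 else 0)"
    proof (cases "\<exists>j \<in> {..<n} - R. T j \<inter> U \<noteq> {}")
      case True
      then obtain j l where j: "j \<in> {..<n} - R" and l: "l \<in> R" "T j \<inter> T l \<noteq> {}"
        unfolding U_def by blast
      have "2 \<le> card (T j \<inter> T l)" using j l R by (intro overlap) auto
      also have "\<dots> \<le> card (U \<inter> T j)" using l finU by (intro card_mono) (auto simp: U_def)
      finally have "card (U \<union> T j) + 2 \<le> card U + card (T j)"
        using card_Un_Int[OF finU fin, of j] by simp
      with j show ?thesis by (intro bexI[of _ j]) auto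
    next
      case False
      then have "q dvd m" using closed[OF R(1)] R(2) unfolding U_def by blast
      moreover have "{..<n} - R \<noteq> {}"
      proof
        assume "{..<n} - R = {}"
        with R have "R = {..<n}" by blast
        with R Suc.prems show False by simp
      qed
      ultimately show ?thesis using card_Un_le[of U] by fastforce
    qed
    then obtain j where j: "j \<in> {..<n} - R"
      and jle: "card (U \<union> T j) + 2 \<le> card U + card (T j) + (if q dvd m then 2 else 0)" by blast
    have "\<Union> (T ` insert j R) = U \<union> T j" unfolding U_def by auto
    moreover have "(\<Sum>i\<in>insert j R. card (T i)) = card (T j) + (\<Sum>i\<in>R. card (T i))"
      using j finR by simp
    ultimately have "card (\<Union> (T ` insert j R)) + 2 * Suc m
        \<le> (\<Sum>i\<in>insert j R. card (T i)) + 2 * card {t. t < Suc m \<and> q dvd t}"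
      using jle le count unfolding U_def by (auto split: if_splits)
    moreover have "insert j R \<subseteq> {..<n}" "card (insert j R) = Suc m" using j R finR by auto
    ultimately show ?case by blast
  qed
  from greedy[of n] obtain R where R: "R \<subseteq> {..<n}" "card R = n"
    and le: "card (\<Union> (T ` R)) + 2 * n \<le> (\<Sum>j\<in>R. card (T j)) + 2 * card {t. t < n \<and> q dvd t}"
    by auto
  have Rn: "R = {..<n}" using R card_subset_eq[of "{..<n}" R] by simp
  \<comment> \<open>A unit vector has a nonzero coordinate, so every column is occupied once all
    rows are chosen.\<close>
  have "\<Union> (T ` {..<n}) = {..<N}"
  proof -
    have "\<exists>j<n. a i j \<noteq> 0" if "i < N" for i
      using unit[OF that] by (metis (no_types, lifting) lessThan_iff power_zero_numeral sum.neutral zero_neq_one)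
    then show ?thesis unfolding T_def by auto
  qed
  moreover have "card {t. t < n \<and> q dvd t} = gcd N n"
    unfolding q_def using n by (intro card_multiples_below) auto
  moreover have "(\<Sum>j<n. card (T j)) = (\<Sum>i<N. card {j. j < n \<and> a i j \<noteq> 0})"
    unfolding T_def using sum_multicount_gen[of "{..<N}" "{..<n}" "\<lambda>i j. a i j \<noteq> 0" "\<lambda>j. card {i. i < N \<and> a i j \<noteq> 0}"]
    by simp
  moreover have "gcd N n \<le> n" using n by simp
  ultimately show ?thesis using le unfolding Rn by simp
qed

section \<open>Symmetric real matrices with a single eigenvalue\<close>

text \<open>Both traces are the same double sum. The identity serves to move the similarity factor
  \<open>P\<close> to the other end of a product.\<close>

lemma sum_diag_mult_mat_commute:
  fixes X Y :: "'a :: comm_semiring_0 mat"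
  assumes "X \<in> carrier_mat n m" "Y \<in> carrier_mat m n"
  shows "(\<Sum>i<n. (X * Y) $$ (i, i)) = (\<Sum>i<m. (Y * X) $$ (i, i))"
proof -
  have "(\<Sum>i<n. (X * Y) $$ (i, i)) = (\<Sum>i<n. \<Sum>j<m. X $$ (i, j) * Y $$ (j, i))"
    using assms by (intro sum.cong refl) (auto simp: scalar_prod_def atLeast0LessThan)
  also have "\<dots> = (\<Sum>j<m. \<Sum>i<n. Y $$ (j, i) * X $$ (i, j))"
    by (subst sum.swap) (simp add: mult.commute)
  also have "\<dots> = (\<Sum>j<m. (Y * X) $$ (j, j))"
    using assms by (intro sum.cong refl) (auto simp: scalar_prod_def atLeast0LessThan)
  finally show ?thesis .
qed

text \<open>
  By Schur decomposition $A - c$ is similar to a strictly upper triangular matrix, so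
  $(A - c)^2$ has trace 0; by symmetry this trace is the sum of the squared entries of $A - c$.
\<close>

lemma symmetric_mat_char_poly_power_imp_scalar:
  fixes A :: "real mat"
  assumes A: "A \<in> carrier_mat n n"
    and sym: "\<And>i j. i < n \<Longrightarrow> j < n \<Longrightarrow> A $$ (i, j) = A $$ (j, i)"
    and cp: "char_poly A = [:- c, 1:] ^ n"
  shows "A = c \<cdot>\<^sub>m 1\<^sub>m n"
proof -
  have cp': "char_poly A = (\<Prod>e \<leftarrow> replicate n c. [:- e, 1:])" using cp by simp
  obtain B P Q where dec: "schur_decomposition A (replicate n c) = (B, P, Q)"
    by (metis prod_cases3)
  from schur_decomposition[OF A cp' dec]
  have wit: "similar_mat_wit A B P Q" and tri: "upper_triangular B"
    and diag: "diag_mat B = replicate n c" by auto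
  define D U where "D = char_matrix A c" and "U = char_matrix B c"
  have "similar_mat_wit D U P Q" unfolding D_def U_def by (rule similar_mat_wit_char_matrix[OF wit])
  moreover have D: "D \<in> carrier_mat n n" unfolding D_def using A by simp
  ultimately have QP: "Q * P = 1\<^sub>m n" and DU: "D = P * U * Q"
    and carr: "U \<in> carrier_mat n n" "P \<in> carrier_mat n n" "Q \<in> carrier_mat n n"
    by (auto dest: similar_mat_witD2)
  have B: "B \<in> carrier_mat n n" using similar_mat_witD2[OF A wit] by simp
  \<comment> \<open>Triangularity gives the zeros below the diagonal; on the diagonal every entry of
    \<open>B\<close> is \<open>c\<close>, which the shift cancels.\<close>
  have U0: "U $$ (i, j) = 0" if "j \<le> i" "i < n" for i j
  proof -
    have "B $$ (i, i) = c"
      using arg_cong[OF diag, of "\<lambda>xs. xs ! i"] that B by (simp add: diag_mat_def)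
    then show ?thesis using tri that B unfolding U_def char_matrix_def
      by (cases "i = j") (auto simp: upper_triangular_def)
  qed
  have QDP: "Q * D * P = U"
  proof -
    have "Q * D * P = (Q * P) * U * (Q * P)"
      unfolding DU using carr by (simp add: assoc_mult_mat[of _ n n _ n _ n])
    then show ?thesis using QP carr by simp
  qed
  \<comment> \<open>Only the first \<open>D\<close> is expanded; after the cyclic shift the factors
    Q * D * P collapse to \<open>U\<close>.\<close>
  have "(\<Sum>i<n. (D * D) $$ (i, i)) = (\<Sum>i<n. (P * (U * (Q * D))) $$ (i, i))"
    using carr D by (subst (1) DU) (simp add: assoc_mult_mat[of _ n n _ n _ n])
  also have "\<dots> = (\<Sum>i<n. (U * (Q * D) * P) $$ (i, i))"
    using carr D by (intro sum_diag_mult_mat_commute) auto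
  also have "U * (Q * D) * P = U * U"
    using carr D QDP by (simp add: assoc_mult_mat[of _ n n _ n _ n])
  also have "(\<Sum>i<n. (U * U) $$ (i, i)) = 0"
  proof (intro sum.neutral ballI)
    fix i assume "i \<in> {..<n}"
    then have i: "i < n" by simp
    \<comment> \<open>One of the positions (i, j) and (j, i) lies on or below the diagonal.\<close>
    have "U $$ (i, j) * U $$ (j, i) = 0" if "j < n" for j
      using U0[of j i] U0[of i j] i that by (cases "j \<le> i") auto
    then show "(U * U) $$ (i, i) = 0" using i carr by (auto simp: scalar_prod_def intro!: sum.neutral)
  qed
  finally have "(\<Sum>i<n. (D * D) $$ (i, i)) = 0" .
  moreover have "(D * D) $$ (i, i) = (\<Sum>j<n. (D $$ (i, j))\<^sup>2)" if "i < n" for i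
    using that D sym A unfolding D_def char_matrix_def
    by (auto simp: scalar_prod_def power2_eq_square atLeast0LessThan intro!: sum.cong)
  ultimately have sum0: "(\<Sum>i<n. \<Sum>j<n. (D $$ (i, j))\<^sup>2) = 0" by simp
  have "D $$ (i, j) = 0" if "i < n" "j < n" for i j
  proof -
    have "(\<Sum>j<n. (D $$ (i, j))\<^sup>2) = 0"
      using sum0 that by (subst (asm) sum_nonneg_eq_0_iff) (auto intro: sum_nonneg)
    then have "(D $$ (i, j))\<^sup>2 = 0"
      using that by (subst (asm) sum_nonneg_eq_0_iff) auto
    then show ?thesis by simp
  qed
  then show ?thesis using A unfolding D_def char_matrix_def
    by (intro eq_matI) (auto split: if_splits)
qed

section \<open>Spans of standard basis vectors\<close>

text \<open>The span is a coordinate subspace, so an index set is admissible for a vector exactly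
  when it contains the support.\<close>

lemma mem_vec_span_unit_vec_iff:
  assumes "J \<subseteq> {..<n}"
  shows "v \<in> vec_span n (unit_vec n ` J) \<longleftrightarrow> v \<in> carrier_vec n \<and> (\<forall>k<n. k \<notin> J \<longrightarrow> v $ k = 0)"
proof -
  interpret V: vec_space "TYPE(real)" n .
  let ?E = "unit_vec n ` J :: real vec set"
  have E: "?E \<subseteq> carrier_vec n" by auto
  have fin: "finite ?E" using assms finite_subset by blast
  have inj: "inj_on (unit_vec n :: nat \<Rightarrow> real vec) J"
    using assms by (intro inj_onI) (auto simp: unit_vec_eq)
  have idx: "V.lincomb a ?E $ k = (if k \<in> J then a (unit_vec n k) else 0)" if "k < n" for a k
  proof -
    have "V.lincomb a ?E $ k = (\<Sum>x\<in>?E. a x * x $ k)" by (rule V.lincomb_index[OF that E])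
    also have "\<dots> = (\<Sum>j\<in>J. a (unit_vec n j) * unit_vec n j $ k)"
      by (simp add: sum.reindex[OF inj])
    also have "\<dots> = (\<Sum>j\<in>J. if j = k then a (unit_vec n k) else 0)"
      using assms that by (intro sum.cong) auto
    also have "\<dots> = (if k \<in> J then a (unit_vec n k) else 0)"
      using assms finite_subset by (subst sum.delta) blast+
    finally show ?thesis .
  qed
  show ?thesis
  proof
    assume "v \<in> vec_span n ?E"
    then obtain a where "v = V.lincomb a ?E"
      unfolding V.finite_span[OF fin E] by auto
    then show "v \<in> carrier_vec n \<and> (\<forall>k<n. k \<notin> J \<longrightarrow> v $ k = 0)"
      using idx V.lincomb_closed[OF E] by auto
  next
    assume v: "v \<in> carrier_vec n \<and> (\<forall>k<n. k \<notin> J \<longrightarrow> v $ k = 0)"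
    \<comment> \<open>Coefficients in \<open>lincomb\<close> are indexed by vectors;
      \<open>THE\<close> recovers the index, unique because the unit vectors are distinct.\<close>
    define a where "a u = v $ (THE k. k < n \<and> u = unit_vec n k)" for u :: "real vec"
    have a: "a (unit_vec n k) = v $ k" if "k < n" for k
    proof -
      have "(THE k'. k' < n \<and> (unit_vec n k :: real vec) = unit_vec n k') = k"
        using that by (intro the_equality) (auto simp: unit_vec_eq)
      then show ?thesis unfolding a_def by simp
    qed
    have "v = V.lincomb a ?E"
      using v a V.lincomb_dim[OF fin E] by (intro eq_vecI) (auto simp: idx)
    then show "v \<in> vec_span n ?E" using fin by (intro V.in_spanI[of _ a ?E]) auto
  qed
qed

section \<open>The frame operator in coordinates\<close>

lemma scalar_prod_eq_sum_lessThan: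
  "v \<in> carrier_vec n \<Longrightarrow> x \<bullet> v = (\<Sum>l<n. x $ l * v $ l)"
  by (auto simp: scalar_prod_def atLeast0LessThan)

lemma frame_operator_carrier:
  "set \<phi> \<subseteq> carrier_vec n \<Longrightarrow> frame_operator n \<phi> x \<in> carrier_vec n"
  unfolding frame_operator_def by (induction \<phi>) auto

lemma frame_operator_index:
  assumes "set \<phi> \<subseteq> carrier_vec n" "k < n"
  shows "frame_operator n \<phi> x $ k = (\<Sum>v\<leftarrow>\<phi>. (x \<bullet> v) * v $ k)"
  using assms
proof (induction \<phi>)
  case (Cons v \<phi>)
  then have "frame_operator n (v # \<phi>) x $ k = ((x \<bullet> v) \<cdot>\<^sub>v v + frame_operator n \<phi> x) $ k"
    by (simp add: frame_operator_def)
  moreover have "dim_vec v = n" "dim_vec (frame_operator n \<phi> x) = n"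
    using Cons.prems carrier_vecD[OF frame_operator_carrier[of \<phi> n x]] by auto
  then have "((x \<bullet> v) \<cdot>\<^sub>v v + frame_operator n \<phi> x) $ k
      = (x \<bullet> v) * v $ k + frame_operator n \<phi> x $ k"
    using Cons.prems(2) by simp
  ultimately show ?case using Cons by simp
qed (simp add: frame_operator_def)

text \<open>\<open>W\<close> is separate from \<open>set \<phi>\<close> so that the span stays fixed
  while the list shrinks in the induction.\<close>

lemma frame_operator_in_span:
  assumes "set \<phi> \<subseteq> W" "W \<subseteq> carrier_vec n"
  shows "frame_operator n \<phi> x \<in> vec_span n W"
proof -
  interpret V: vec_space "TYPE(real)" n .
  show ?thesis
    using assms
  proof (induction \<phi>)
    case Nil
    have "V.lincomb (\<lambda>_. 0) {} = 0\<^sub>v n" unfolding V.lincomb_def by simp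
    then show ?case using V.in_spanI[of "0\<^sub>v n" "\<lambda>_. 0" "{}" W] by (simp add: frame_operator_def)
  next
    case (Cons v \<phi>)
    then have "(x \<bullet> v) \<cdot>\<^sub>v v \<in> V.span W" by (intro V.smult_in_span V.span_mem) auto
    moreover have "frame_operator n \<phi> x \<in> V.span W" using Cons by simp
    ultimately show ?case using V.span_add1[of W] Cons.prems by (simp add: frame_operator_def)
  qed
qed

text \<open>The entries are the inner products of the rows of the matrix with columns
  \<open>\<phi>\<close>, which links the spectrum to row orthogonality.\<close>

lemma frame_operator_mat_index:
  assumes "set \<phi> \<subseteq> carrier_vec n" "k < n" "l < n"
  shows "frame_operator_mat n \<phi> $$ (k, l) = (\<Sum>v\<leftarrow>\<phi>. v $ k * v $ l)"
proof -
  have "(\<Sum>v\<leftarrow>\<phi>. (unit_vec n l \<bullet> v) * v $ k) = (\<Sum>v\<leftarrow>\<phi>. v $ k * v $ l)"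
    using assms by (intro arg_cong[of _ _ sum_list] map_cong refl)
      (auto simp: scalar_prod_left_unit subset_iff)
  then show ?thesis
    using assms by (simp add: frame_operator_mat_def frame_operator_index)
qed

text \<open>A symmetric matrix with characteristic polynomial (x - c)^n is scalar, so the rows are
  orthogonal of squared norm \<open>c\<close>. Conversely x = (1 / c) S x places every x in the span
  of the frame.\<close>

lemma frame_class_const_iff:
  assumes c: "c \<noteq> 0"
  shows "\<phi> \<in> frame_class n N (\<lambda>_. c) \<longleftrightarrow>
    length \<phi> = N \<and> set \<phi> \<subseteq> carrier_vec n \<and> (\<forall>v \<in> set \<phi>. v \<bullet> v = 1) \<and>
    (\<forall>k<n. \<forall>l<n. (\<Sum>v\<leftarrow>\<phi>. v $ k * v $ l) = (if k = l then c else 0))"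
    (is "?L \<longleftrightarrow> ?R")
proof
  assume ?L
  then have \<phi>: "length \<phi> = N" "set \<phi> \<subseteq> carrier_vec n" "\<forall>v \<in> set \<phi>. v \<bullet> v = 1"
    and cp: "char_poly (frame_operator_mat n \<phi>) = [:- c, 1:] ^ n"
    unfolding frame_class_def is_frame_def unit_norm_def by auto
  have "frame_operator_mat n \<phi> = c \<cdot>\<^sub>m 1\<^sub>m n"
    using frame_operator_mat_index[OF \<phi>(2)] cp
    by (intro symmetric_mat_char_poly_power_imp_scalar) (auto simp: frame_operator_mat_def mult.commute)
  then have "(\<Sum>v\<leftarrow>\<phi>. v $ k * v $ l) = (if k = l then c else 0)" if "k < n" "l < n" for k l
    using frame_operator_mat_index[OF \<phi>(2) that] that by (cases "k = l") auto
  with \<phi> show ?R by blast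
next
  assume R: ?R
  have car: "set \<phi> \<subseteq> carrier_vec n" using R by blast
  have mat: "frame_operator_mat n \<phi> = c \<cdot>\<^sub>m 1\<^sub>m n"
    using R frame_operator_mat_index[OF car]
    by (intro eq_matI) (auto simp: frame_operator_mat_def)
  have "upper_triangular (c \<cdot>\<^sub>m 1\<^sub>m n :: real mat)" by (auto simp: upper_triangular_def)
  moreover have "diag_mat (c \<cdot>\<^sub>m 1\<^sub>m n :: real mat) = replicate n c"
    by (intro nth_equalityI) (auto simp: diag_mat_def)
  ultimately have "char_poly (frame_operator_mat n \<phi>) = [:- c, 1:] ^ n"
    unfolding mat by (subst char_poly_upper_triangular[of _ n]) auto
  moreover have "vec_span n (set \<phi>) = carrier_vec n"
  proof -
    interpret V: vec_space "TYPE(real)" n .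
    have "x \<in> V.span (set \<phi>)" if x: "x \<in> carrier_vec n" for x
    proof -
      have sx: "frame_operator n \<phi> x $ k = c * x $ k" if k: "k < n" for k
      proof -
        have "frame_operator n \<phi> x $ k = (\<Sum>v\<leftarrow>\<phi>. \<Sum>l<n. x $ l * (v $ k * v $ l))"
          unfolding frame_operator_index[OF car k]
        proof (intro arg_cong[of _ _ sum_list] map_cong refl)
          fix v assume "v \<in> set \<phi>"
          then have "v \<in> carrier_vec n" using car by blast
          then show "(x \<bullet> v) * v $ k = (\<Sum>l<n. x $ l * (v $ k * v $ l))"
            by (simp add: scalar_prod_eq_sum_lessThan sum_distrib_left mult_ac)
        qed
        also have "\<dots> = (\<Sum>l<n. x $ l * (\<Sum>v\<leftarrow>\<phi>. v $ k * v $ l))"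
          by (induction \<phi>) (auto simp: sum.distrib algebra_simps)
        also have "\<dots> = (\<Sum>l<n. if l = k then c * x $ k else 0)"
          using R k by (intro sum.cong refl) auto
        finally show ?thesis using k by simp
      qed
      have "x = (1 / c) \<cdot>\<^sub>v frame_operator n \<phi> x"
        using x c sx frame_operator_carrier[OF car, of x] by (intro eq_vecI) auto
      then show ?thesis
        using V.smult_in_span[OF car frame_operator_in_span[OF subset_refl car]] by metis
    qed
    then show ?thesis using V.span_is_subset2[OF car] by auto
  qed
  ultimately show ?L
    using R unfolding frame_class_def is_frame_def unit_norm_def by auto
qed

section \<open>Lower bound on the sparsity of unit norm tight frames\<close>

text \<open>Any admissible \<open>J i\<close> contains the support of vector \<open>i\<close>, so
  the bound on nonzero entries passes to every witness of sparsity.\<close>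

lemma frame_class_const_sparse_ge:
  assumes "n > 0" "N > 0"
    and \<psi>: "\<psi> \<in> frame_class n N (\<lambda>_. real N / real n)"
    and sparse: "is_sparse n (unit_vec n) k \<psi>"
  shows "N + 2 * (n - gcd N n) \<le> k"
proof -
  have c: "real N / real n \<noteq> 0" using assms by simp
  from \<psi> have len: "length \<psi> = N" and car: "set \<psi> \<subseteq> carrier_vec n"
    and unit: "\<forall>v \<in> set \<psi>. v \<bullet> v = 1"
    and gram: "\<forall>k<n. \<forall>l<n. (\<Sum>v\<leftarrow>\<psi>. v $ k * v $ l) = (if k = l then real N / real n else 0)"
    unfolding frame_class_const_iff[OF c] by blast+
  from sparse obtain J where J: "\<And>i. i < N \<Longrightarrow> J i \<subseteq> {..<n}"
    "\<And>i. i < N \<Longrightarrow> \<psi> ! i \<in> vec_span n (unit_vec n ` J i)"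
    and k: "(\<Sum>i<N. card (J i)) = k"
    unfolding is_sparse_def len by blast
  have gram': "(\<Sum>i<N. \<psi> ! i $ j * \<psi> ! i $ l) = (if j = l then real N / real n else 0)"
    if "j < n" "l < n" for j l
    using gram that by (simp add: sum_list_sum_nth len atLeast0LessThan)
  have "N + 2 * (n - gcd N n) \<le> (\<Sum>i<N. card {j. j < n \<and> \<psi> ! i $ j \<noteq> 0})"
  proof (rule orthogonal_rows_card_support_ge[OF \<open>n > 0\<close>])
    fix i assume "i < N"
    then have "\<psi> ! i \<in> set \<psi>" using len by simp
    then have "\<psi> ! i \<in> carrier_vec n" "\<psi> ! i \<bullet> \<psi> ! i = 1" using car unit by auto
    then show "(\<Sum>j<n. (\<psi> ! i $ j)\<^sup>2) = 1"
      by (simp add: scalar_prod_eq_sum_lessThan power2_eq_square)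
  qed (use gram' in \<open>auto simp: power2_eq_square\<close>)
  also have "\<dots> \<le> (\<Sum>i<N. card (J i))"
  proof (intro sum_mono card_mono)
    fix i assume "i \<in> {..<N}"
    then have i: "i < N" by simp
    show "finite (J i)" using J(1)[OF i] finite_subset by blast
    show "{j. j < n \<and> \<psi> ! i $ j \<noteq> 0} \<subseteq> J i"
      using J(2)[OF i] unfolding mem_vec_span_unit_vec_iff[OF J(1)[OF i]] by blast
  qed
  finally show ?thesis using k by simp
qed

section \<open>Correctness and sparsity of the Spectral Tetris output\<close>

lemma is_sparse_Nil: "is_sparse n e 0 []"
  by (simp add: is_sparse_def)

lemma is_sparse_Cons:
  assumes "A \<subseteq> {..<n}" "v \<in> vec_span n (e ` A)" "is_sparse n e k \<phi>"
  shows "is_sparse n e (card A + k) (v # \<phi>)"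
proof -
  from assms(3) obtain J where J: "\<forall>i < length \<phi>. J i \<subseteq> {..<n} \<and> \<phi> ! i \<in> vec_span n (e ` J i)"
    "(\<Sum>i < length \<phi>. card (J i)) = k"
    unfolding is_sparse_def by blast
  let ?J = "case_nat A J"
  have "\<forall>i < length (v # \<phi>). ?J i \<subseteq> {..<n} \<and> (v # \<phi>) ! i \<in> vec_span n (e ` ?J i)"
    using J(1) assms(1,2) by (auto split: nat.split)
  moreover have "(\<Sum>i < length (v # \<phi>). card (?J i)) = card A + k"
    using J(2) by (simp add: sum.lessThan_Suc_shift del: sum.lessThan_Suc)
  ultimately show ?thesis unfolding is_sparse_def by blast
qed

text \<open>
  The third hypothesis allows both for a value $\lambda_j$ just reduced by a two-vector step
  (then \<open>\<mu> j\<close> may be below 2) and for the state right after such a step, where \<open>\<mu> j = 0\<close> and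
  \<open>\<mu> (Suc j)\<close> has been reduced.
\<close>

lemma stf_loop_correct:
  assumes "0 \<le> \<mu> j" "0 \<le> \<mu> (Suc j)" "\<mu> j = 0 \<or> 2 \<le> \<mu> (Suc j)" "\<And>k. k > Suc j \<Longrightarrow> 2 \<le> \<mu> k"
    and "(\<Sum>k=j..<n. \<mu> k) \<in> \<int>"
  shows "set (stf_loop n j \<mu>) \<subseteq> carrier_vec n" (is "?A n j \<mu>")
    and "\<forall>v \<in> set (stf_loop n j \<mu>). v \<bullet> v = 1" (is "?B n j \<mu>")
    and "\<forall>k<n. \<forall>l<n. (\<Sum>v\<leftarrow>stf_loop n j \<mu>. v $ k * v $ l) = (if k = l \<and> j \<le> k then \<mu> k else 0)"
      (is "?C n j \<mu>")
    and "is_sparse n (unit_vec n)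
      (length (stf_loop n j \<mu>) + 2 * card {k. j \<le> k \<and> k < n \<and> (\<Sum>l=Suc k..<n. \<mu> l) \<notin> \<int>})
      (stf_loop n j \<mu>)" (is "?D n j \<mu>")
proof -
  \<comment> \<open>\<open>?C\<close> says that the vectors still to be emitted account for exactly
    the remaining values; \<open>?D\<close> charges 2 extra entries to each row after which the tail
    sum is not an integer.\<close>
  have "?A n j \<mu> \<and> ?B n j \<mu> \<and> ?C n j \<mu> \<and> ?D n j \<mu>"
    using assms
  proof (induction n j \<mu> rule: stf_loop.induct)
    case (1 n j \<mu>)
    note pre = "1.prems"
    let ?K = "\<lambda>j \<mu>. {k. j \<le> k \<and> k < n \<and> (\<Sum>l=Suc k..<n. \<mu> l) \<notin> \<int>}"
    have fin: "finite (?K j \<mu>)" for j \<mu> by (rule finite_subset[of _ "{..<n}"]) auto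
    have split: "(\<Sum>k=j..<n. \<mu> k) = \<mu> j + (\<Sum>k=Suc j..<n. \<mu> k)" if "j < n" for \<mu> :: "nat \<Rightarrow> real"
      using that by (simp add: sum.atLeast_Suc_lessThan)
    consider (stop) "j \<ge> n" | (skip) "j < n" "\<mu> j = 0" | (pair) "j < n" "\<mu> j \<noteq> 0" "\<mu> j < 1"
      | (single) "j < n" "1 \<le> \<mu> j" by fastforce
    then show ?case
    proof cases
      case stop
      then have *: "stf_loop n j \<mu> = []" "?K j \<mu> = {}" by (auto simp: stf_loop.simps)
      show ?thesis unfolding * using stop by (simp add: is_sparse_Nil)
    next
      case skip
      then have eq: "stf_loop n j \<mu> = stf_loop n (Suc j) \<mu>" by (subst stf_loop.simps) simp
      \<comment> \<open>Removing a zero value keeps the sum integral, so row \<open>j\<close> is not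
        counted in \<open>?K j \<mu>\<close>.\<close>
      have int: "(\<Sum>k=Suc j..<n. \<mu> k) \<in> \<int>" using pre(5) split[of \<mu>] skip by simp
      have "?A n (Suc j) \<mu> \<and> ?B n (Suc j) \<mu> \<and> ?C n (Suc j) \<mu> \<and> ?D n (Suc j) \<mu>"
        using pre skip int order.trans[OF _ pre(4), of 0 "Suc (Suc j)"] by (intro "1.IH"(1)) auto
      moreover have "k \<noteq> j" if "(\<Sum>l=Suc k..<n. \<mu> l) \<notin> \<int>" for k using int that by auto
      then have "?K j \<mu> = ?K (Suc j) \<mu>" by (auto simp: Suc_le_eq le_less)
      ultimately show ?thesis using skip unfolding eq by (auto simp: Suc_le_eq le_less)
    next
      case pair
      define a b where "a = sqrt (\<mu> j / 2)" and "b = sqrt (1 - \<mu> j / 2)"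
      define v w where "v = a \<cdot>\<^sub>v unit_vec n j + b \<cdot>\<^sub>v unit_vec n (Suc j)"
        and "w = a \<cdot>\<^sub>v unit_vec n j - b \<cdot>\<^sub>v unit_vec n (Suc j)"
      define \<nu> where "\<nu> = \<mu>(Suc j := \<mu> (Suc j) - (2 - \<mu> j), j := 0)"
      have pos: "0 < \<mu> j" using pair pre(1) by simp
      have aa: "a * a = \<mu> j / 2" and bb: "b * b = 1 - \<mu> j / 2"
        unfolding a_def b_def using pair pos by auto
      have eq: "stf_loop n j \<mu> = v # w # stf_loop n j \<nu>"
        unfolding v_def w_def a_def b_def \<nu>_def using pair by (subst stf_loop.simps) simp
      have nonint: "\<mu> j \<notin> \<int>" using pos pair by (auto elim!: Ints_cases)
      \<comment> \<open>In the last row the remaining sum would be \<open>\<mu> j\<close> alone,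
        which is not an integer; so \<open>unit_vec n (Suc j)\<close> is a genuine basis
        vector.\<close>
      have Sj: "Suc j < n"
      proof (rule ccontr)
        assume "\<not> Suc j < n"
        then have "(\<Sum>k=Suc j..<n. \<mu> k) = 0" by simp
        then show False using pre(5) split[of \<mu>] pair nonint by simp
      qed
      have tail: "(\<Sum>k=Suc j..<n. \<nu> k) = (\<Sum>k=Suc j..<n. \<mu> k) - (2 - \<mu> j)"
        using Sj by (simp add: sum.atLeast_Suc_lessThan \<nu>_def)
      have tail2: "(\<Sum>l=Suc k..<n. \<nu> l) = (\<Sum>l=Suc k..<n. \<mu> l)" if "k > j" for k
        using that by (intro sum.cong) (auto simp: \<nu>_def)
      \<comment> \<open>The pair uses up exactly 2 of the remaining sum, so the new tail is
        integral, whereas the old one differs from an integer by \<open>\<mu> j\<close>. Hence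
        \<open>j\<close> is counted for \<open>\<mu>\<close> but not for
        \<open>\<nu>\<close>.\<close>
      have int: "(\<Sum>k=Suc j..<n. \<nu> k) \<in> \<int>"
        unfolding tail using pre(5) split[OF pair(1), of \<mu>] Ints_diff[OF _ Ints_numeral, of _ "num.Bit0 num.One"]
        by (simp add: algebra_simps)
      have intj: "(\<Sum>k=j..<n. \<nu> k) \<in> \<int>" using int split[OF pair(1), of \<nu>] by (simp add: \<nu>_def)
      have notint: "(\<Sum>k=Suc j..<n. \<mu> k) \<notin> \<int>"
      proof
        assume "(\<Sum>k=Suc j..<n. \<mu> k) \<in> \<int>"
        from Ints_diff[OF pre(5) this] split[OF pair(1), of \<mu>] nonint show False by simp
      qed
      \<comment> \<open>As \<open>\<mu> j\<close> is nonzero, \<open>\<mu> (Suc j)\<close> is at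
        least 2 and stays nonnegative after the subtraction; the third hypothesis holds through
        \<open>\<nu> j = 0\<close>.\<close>
      have IH: "?A n j \<nu> \<and> ?B n j \<nu> \<and> ?C n j \<nu> \<and> ?D n j \<nu>"
        unfolding \<nu>_def
        by (rule "1.IH"(2)) (use pair pre pos intj in \<open>auto simp: \<nu>_def\<close>)
      have car: "v \<in> carrier_vec n" "w \<in> carrier_vec n" unfolding v_def w_def by auto
      have vi: "v $ k = (if k = j then a else if k = Suc j then b else 0)"
        and wi: "w $ k = (if k = j then a else if k = Suc j then - b else 0)" if "k < n" for k
        unfolding v_def w_def using that pair Sj by auto
      have two: "(\<Sum>k<n. f k) = f j + f (Suc j)"
        if "\<And>k. k \<noteq> j \<Longrightarrow> k \<noteq> Suc j \<Longrightarrow> k < n \<Longrightarrow> f k = 0" for f :: "nat \<Rightarrow> real"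
      proof -
        have "(\<Sum>k<n. f k) = (\<Sum>k\<in>{j, Suc j}. f k)"
          using that Sj by (intro sum.mono_neutral_right) auto
        then show ?thesis by simp
      qed
      have norm: "v \<bullet> v = 1" "w \<bullet> w = 1"
      proof -
        have "v \<bullet> v = (\<Sum>k<n. v $ k * v $ k)" "w \<bullet> w = (\<Sum>k<n. w $ k * w $ k)"
          using car by (simp_all add: scalar_prod_eq_sum_lessThan)
        then show "v \<bullet> v = 1" "w \<bullet> w = 1"
          using two[of "\<lambda>k. v $ k * v $ k"] two[of "\<lambda>k. w $ k * w $ k"] vi wi Sj aa bb by auto
      qed
      \<comment> \<open>The cross terms a b and - a b cancel. The diagonal receives 2 a^2 =
        \<open>\<mu> j\<close> in row \<open>j\<close> and 2 b^2 = \<open>2 - \<mu> j\<close> in row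
        \<open>Suc j\<close>, the amounts by which \<open>\<nu>\<close> differs from
        \<open>\<mu>\<close>.\<close>
      have C: "?C n j \<mu>"
      proof (intro allI impI)
        fix k l assume kl: "k < n" "l < n"
        have "(\<Sum>v\<leftarrow>stf_loop n j \<mu>. v $ k * v $ l)
            = v $ k * v $ l + w $ k * w $ l + (if k = l \<and> j \<le> k then \<nu> k else 0)"
          unfolding eq using IH kl by simp
        then show "(\<Sum>v\<leftarrow>stf_loop n j \<mu>. v $ k * v $ l) = (if k = l \<and> j \<le> k then \<mu> k else 0)"
          using kl aa bb by (auto simp: vi wi \<nu>_def)
      qed
      have K: "?K j \<mu> = insert j (?K j \<nu>)"
        using notint pair tail2 by (auto simp: le_less)
      have "j \<notin> ?K j \<nu>" using int by simp
      with K have cardK: "card (?K j \<mu>) = Suc (card (?K j \<nu>))" using fin by simp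
      have J: "{j, Suc j} \<subseteq> {..<n}" using Sj by auto
      have sp: "v \<in> vec_span n (unit_vec n ` {j, Suc j})" "w \<in> vec_span n (unit_vec n ` {j, Suc j})"
        unfolding mem_vec_span_unit_vec_iff[OF J] using car vi wi by auto
      \<comment> \<open>The four entries are one for each of the two vectors and 2 for the newly
        counted row \<open>j\<close>.\<close>
      have "is_sparse n (unit_vec n) (card {j, Suc j} + (card {j, Suc j}
          + (length (stf_loop n j \<nu>) + 2 * card (?K j \<nu>)))) (stf_loop n j \<mu>)"
        unfolding eq using IH J sp by (intro is_sparse_Cons) auto
      then have D: "?D n j \<mu>" unfolding cardK by (simp add: eq)
      show ?thesis using IH C D car norm eq by auto
    next
      case single
      define \<nu> where "\<nu> = \<mu>(j := \<mu> j - 1)"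
      have eq: "stf_loop n j \<mu> = unit_vec n j # stf_loop n j \<nu>"
        unfolding \<nu>_def using single by (subst stf_loop.simps) simp
      have tail: "(\<Sum>l=Suc k..<n. \<nu> l) = (\<Sum>l=Suc k..<n. \<mu> l)" if "j \<le> k" for k
        using that by (intro sum.cong) (auto simp: \<nu>_def)
      have "(\<Sum>k=j..<n. \<nu> k) = (\<Sum>k=j..<n. \<mu> k) - 1"
        using split[OF single(1), of \<nu>] split[OF single(1), of \<mu>] tail[of j] by (simp add: \<nu>_def)
      then have int: "(\<Sum>k=j..<n. \<nu> k) \<in> \<int>" using pre(5) by simp
      have IH: "?A n j \<nu> \<and> ?B n j \<nu> \<and> ?C n j \<nu> \<and> ?D n j \<nu>"
        unfolding \<nu>_def
        by (rule "1.IH"(3)) (use single pre int in \<open>auto simp: \<nu>_def\<close>)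
      have \<nu>: "\<nu> j = \<mu> j - 1" "\<And>k. k \<noteq> j \<Longrightarrow> \<nu> k = \<mu> k" by (auto simp: \<nu>_def)
      have C: "?C n j \<mu>"
        using IH single unfolding eq by (auto simp: \<nu>)
      \<comment> \<open>Tails after a row k >= j do not involve the value at \<open>j\<close>, the
        only one that changed.\<close>
      have K: "?K j \<mu> = ?K j \<nu>" using tail by auto
      have "unit_vec n j \<in> vec_span n (unit_vec n ` {j})"
        using single by (subst mem_vec_span_unit_vec_iff) auto
      then have "is_sparse n (unit_vec n) (card {j}
          + (length (stf_loop n j \<nu>) + 2 * card (?K j \<nu>))) (stf_loop n j \<mu>)"
        unfolding eq using IH single by (intro is_sparse_Cons) auto
      then have D: "?D n j \<mu>" unfolding K by (simp add: eq)
      show ?thesis using IH C D single eq by auto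
    qed
  qed
  then show "?A n j \<mu>" "?B n j \<mu>" "?C n j \<mu>" "?D n j \<mu>" by blast+
qed

section \<open>Counting the two-vector steps and conclusion\<close>

text \<open>The tail after \<open>k\<close> has \<open>n - Suc k\<close> terms N / n, so it is
  integral iff n / gcd(N, n) divides \<open>n - Suc k\<close>. Reversing the index turns this into
  counting multiples below \<open>n\<close>.\<close>

lemma card_nonintegral_tails:
  fixes n N :: nat
  assumes "n > 0"
  shows "card {k. k < n \<and> (\<Sum>l=Suc k..<n. real N / real n) \<notin> \<int>} = n - gcd N n"
proof -
  let ?q = "n div gcd N n"
  have "{k. k < n \<and> (\<Sum>l=Suc k..<n. real N / real n) \<notin> \<int>}
      = {..<n} - {k. k < n \<and> ?q dvd n - Suc k}"
    using real_mult_divide_in_Ints_iff[OF assms] by auto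
  moreover have "bij_betw (\<lambda>k. n - Suc k) {k. k < n \<and> ?q dvd n - Suc k} {t. t < n \<and> ?q dvd t}"
    by (rule bij_betw_byWitness[where f' = "\<lambda>k. n - Suc k"]) auto
  then have "card {k. k < n \<and> ?q dvd n - Suc k} = gcd N n"
    using card_multiples_below[of "gcd N n" n] assms by (simp add: bij_betw_same_card)
  ultimately show ?thesis by (simp add: card_Diff_subset subset_iff)
qed

theorem corollary4p6:
  fixes n N :: nat
  assumes "n > 0" and "N > 0" and "real N / real n \<ge> 2"
  shows "optimally_sparse n (unit_vec n) (frame_class n N (\<lambda>_. real N / real n))
           (STF n (\<lambda>_. real N / real n)) \<and>
         is_sparse n (unit_vec n) (N + 2 * (n - gcd N n)) (STF n (\<lambda>_. real N / real n)) \<and>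
         \<not> (\<exists>\<psi> \<in> frame_class n N (\<lambda>_. real N / real n).
               \<exists>k < N + 2 * (n - gcd N n). is_sparse n (unit_vec n) k \<psi>)"
proof -
  let ?c = "real N / real n"
  define \<phi> where "\<phi> = STF n (\<lambda>_. ?c)"
  have "(\<Sum>k=0..<n. ?c) \<in> \<int>" using assms by simp
  note correct = stf_loop_correct[of "\<lambda>_. ?c" 0 n, OF _ _ _ _ this, folded STF_def]
  have car: "set \<phi> \<subseteq> carrier_vec n" and unit: "\<forall>v \<in> set \<phi>. v \<bullet> v = 1"
    and gram: "\<forall>k<n. \<forall>l<n. (\<Sum>v\<leftarrow>\<phi>. v $ k * v $ l) = (if k = l then ?c else 0)"
    and sparse: "is_sparse n (unit_vec n) (length \<phi> + 2 * (n - gcd N n)) \<phi>"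
    unfolding \<phi>_def using correct assms card_nonintegral_tails[OF assms(1), of N] by auto
  \<comment> \<open>The loop lemma leaves the length open. It is the sum of the squared norms, that
    is, the trace of the frame operator, which is n * (N / n).\<close>
  have "real (length \<phi>) = (\<Sum>v\<leftarrow>\<phi>. \<Sum>k<n. v $ k * v $ k)"
  proof -
    have "(\<Sum>k<n. v $ k * v $ k) = 1" if "v \<in> set \<phi>" for v
      using that car unit scalar_prod_eq_sum_lessThan[of v n v] by auto
    then have "(\<Sum>v\<leftarrow>\<phi>. \<Sum>k<n. v $ k * v $ k) = (\<Sum>v\<leftarrow>\<phi>. 1)"
      by (intro arg_cong[of _ _ sum_list] map_cong) auto
    then show ?thesis by (simp add: sum_list_triv)
  qed
  also have "\<dots> = (\<Sum>k<n. \<Sum>v\<leftarrow>\<phi>. v $ k * v $ k)"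
    by (induction \<phi>) (auto simp: sum.distrib)
  also have "\<dots> = real N" using gram assms by simp
  finally have len: "length \<phi> = N" by simp
  have mem: "\<phi> \<in> frame_class n N (\<lambda>_. ?c)"
    using car unit gram len assms by (subst frame_class_const_iff) auto
  have "\<not> (\<exists>\<psi> \<in> frame_class n N (\<lambda>_. ?c). \<exists>k < N + 2 * (n - gcd N n). is_sparse n (unit_vec n) k \<psi>)"
    using frame_class_const_sparse_ge[OF assms(1,2)] by (meson not_le)
  with mem sparse show ?thesis unfolding optimally_sparse_def \<phi>_def[symmetric] len by blast
qed

end
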